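(* Suppose (i) $G$ is a connected undirected graph on $\{1,\dots,n\}$; (ii) for a nonempty set $S\subseteq\{1,\dots,n\}$ and a vector $\mathbf{v}\in\mathbb{R}^d$, each node $i\in S$ sets $\mathbf{x}_i(t)=\mathbf{y}_i(t)=\mathbf{v}$ for all $t\ge1$; (iii) each node $i\notin S$ starts from an arbitrary $\mathbf{x}_i(1)\in\mathbb{R}^d$ with $\mathbf{y}_i(1)=\mathbf{x}_i(1)$ and updates, for all $t\ge1$, $$\mathbf{y}_i(t+1)=\mathbf{x}_i(t)+\frac12\sum_{j\in N(i)}\frac{\mathbf{x}_j(t)-\mathbf{x}_i(t)}{\max(d(i),d(j))},$$ $$\mathbf{x}_i(t+1)=\mathbf{y}_i(t+1)+\left(1-\frac{2}{18U+1}\right)\left(\mathbf{y}_i(t+1)-\mathbf{y}_i(t)\right);$$ (iv) $U\ge n$. Then for all $t\ge1$, $$\sum_{i=1}^n\|\mathbf{y}_i(t)-\mathbf{v}\|_2^2\le 2\left(1-\frac{1}{18U}\right)^{t-1}\sum_{i=1}^n\|\mathbf{y}_i(1)-\mathbf{v}\|_2^2 .$$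
   Context: $N(i)$ is the set of neighbors of node $i$ in $G$ (with $i\notin N(i)$) and $d(i)$ is the degree of $i$ in $G$. *)

theory Defs
  imports "HOL-Analysis.Analysis" "Graph_Theory.Graph_Theory"
begin

(* Undirected simple graphs are the library's pair_graph: finite, loop-free, symmetric
   pair digraphs, an edge {i, j} being the two arcs (i, j) and (j, i). Hence the degree
   of a node is the number of arcs leaving it.
   The constant "connected" of Digraph_Component is qualified because HOL-Analysis has
   a topological constant of the same name. *)

abbreviation connected_graph :: "'a pair_pre_digraph \<Rightarrow> bool" where
  "connected_graph G \<equiv> pair_graph G \<and> Digraph_Component.connected (with_proj G)"

abbreviation nbrs :: "'a pair_pre_digraph \<Rightarrow> 'a \<Rightarrow> 'a set" where
  "nbrs G i \<equiv> {j. (i, j) \<in> parcs G}"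

abbreviation deg :: "'a pair_pre_digraph \<Rightarrow> 'a \<Rightarrow> nat" where
  "deg G i \<equiv> out_degree (with_proj G) i"

end

theory Submission
  imports Defs
begin

text \<open>Subtract \<open>v\<close> throughout. The stubborn nodes in \<open>S\<close> then carry the value 0, and the deviations
\<open>x\<close>, \<open>y\<close> at the remaining nodes \<open>T\<close> satisfy \<open>y (t + 1) = Q (x t)\<close>, where \<open>Q\<close> is the principal
submatrix on \<open>T\<close> of the lazy Metropolis matrix. Put \<open>\<eta> = 18 U\<close>. The momentum coefficient is
\<open>(\<eta> - 1) / (\<eta> + 1)\<close>, so the iteration is Nesterov's accelerated gradient descent for the
quadratic function with Hessian \<open>I - Q\<close>, tuned to the condition number \<open>\<eta>\<^sup>2\<close>. Two things have to
be shown.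

The first is that under Nesterov's method \<open>|y|\<^sup>2\<close> is at most \<open>2 (1 - 1/\<eta>) ^ k\<close> times its
initial value after \<open>k\<close> steps, as soon as the spectrum of \<open>Q\<close> lies in \<open>[0, 1 - 1/\<eta>\<^sup>2]\<close>
(\<open>accelerated_iteration\<close>). The usual potential controls the value of the quadratic function;
recovering \<open>|y|\<^sup>2\<close> from it would cost a factor \<open>\<eta>\<^sup>2\<close>. Applying it to each eigenvector separately
and dividing by the eigenvalue avoids this loss. The sum over the eigenvectors is
\<open>|y|\<^sup>2 + \<langle>u, (I - Q)\<^sup>-\<^sup>1 u\<rangle> / \<eta>\<^sup>2\<close> for a combination \<open>u\<close> of \<open>x\<close> and \<open>y\<close>, an expression that
makes sense without diagonalising \<open>Q\<close>. Its decrease is a polynomial identity together with the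
operator inequalities \<open>0 \<le> Q \<le> 1 - 1/\<eta>\<^sup>2\<close> (\<open>lyapunov_step\<close>).

The second is the spectral bound itself. Laziness gives \<open>Q \<ge> 0\<close>. The form of \<open>I - Q\<close> is a
quarter of the Dirichlet energy of the Metropolis weights, summed over arcs, so the gap is a
Poincare inequality for functions that vanish on \<open>S\<close> (\<open>poincare\<close>). It follows from the
Cauchy-Schwarz inequality along shortest paths to \<open>S\<close>: the degrees along such a path add up to
\<open>O(n)\<close>, since a vertex has its neighbours within one level of its own distance to \<open>S\<close>. The
resulting gap \<open>1 / (4 n)\<^sup>2\<close> exceeds \<open>1 / (18 U)\<^sup>2\<close>.\<close>

section \<open>Matrices acting on vector-valued functions\<close>

definition inner_on :: "'i set \<Rightarrow> ('i \<Rightarrow> 'b::real_inner) \<Rightarrow> ('i \<Rightarrow> 'b) \<Rightarrow> real" where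
  "inner_on T f g = (\<Sum>i\<in>T. f i \<bullet> g i)"

definition apply_matrix :: "'i set \<Rightarrow> ('i \<Rightarrow> 'i \<Rightarrow> real) \<Rightarrow> ('i \<Rightarrow> 'b::real_vector) \<Rightarrow> 'i \<Rightarrow> 'b" where
  "apply_matrix T q f i = (\<Sum>j\<in>T. q i j *\<^sub>R f j)"

lemma inner_on_commute: "inner_on T f g = inner_on T g f"
  by (simp add: inner_on_def inner_commute)

lemma inner_on_cong:
  assumes "\<And>i. i \<in> T \<Longrightarrow> f i = f' i" "\<And>i. i \<in> T \<Longrightarrow> g i = g' i"
  shows "inner_on T f g = inner_on T f' g'"
  using assms by (auto simp: inner_on_def intro!: sum.cong)

lemma inner_on_linear:
  "inner_on T (\<lambda>i. f i + g i) k = inner_on T f k + inner_on T g k"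
  "inner_on T k (\<lambda>i. f i + g i) = inner_on T k f + inner_on T k g"
  "inner_on T (\<lambda>i. f i - g i) k = inner_on T f k - inner_on T g k"
  "inner_on T k (\<lambda>i. f i - g i) = inner_on T k f - inner_on T k g"
  "inner_on T (\<lambda>i. c *\<^sub>R f i) k = c * inner_on T f k"
  "inner_on T k (\<lambda>i. c *\<^sub>R f i) = c * inner_on T k f"
  by (simp_all add: inner_on_def inner_add_left inner_add_right inner_diff_left
      inner_diff_right sum.distrib sum_subtractf sum_distrib_left)

lemma inner_on_self: "inner_on T f f = (\<Sum>i\<in>T. (norm (f i))\<^sup>2)"
  by (simp add: inner_on_def power2_norm_eq_inner)

lemma inner_on_self_nonneg: "inner_on T f f \<ge> 0"
  by (simp add: inner_on_self sum_nonneg)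

lemma apply_matrix_cong:
  assumes "\<And>i. i \<in> T \<Longrightarrow> f i = g i"
  shows "apply_matrix T q f = apply_matrix T q g"
  using assms by (auto simp: apply_matrix_def intro!: sum.cong)

lemma apply_matrix_linear:
  "apply_matrix T q (\<lambda>i. f i + g i) = (\<lambda>i. apply_matrix T q f i + apply_matrix T q g i)"
  "apply_matrix T q (\<lambda>i. f i - g i) = (\<lambda>i. apply_matrix T q f i - apply_matrix T q g i)"
  "apply_matrix T q (\<lambda>i. c *\<^sub>R f i) = (\<lambda>i. c *\<^sub>R apply_matrix T q f i)"
  by (auto simp: apply_matrix_def scaleR_add_right scaleR_diff_right sum.distrib sum_subtractf
      scaleR_sum_right mult.commute)

section \<open>Symmetric matrices with a spectral gap\<close>

text \<open>A symmetric matrix \<open>q\<close> on the index set \<open>T\<close> whose spectrum lies in \<open>[0, 1 - \<gamma>]\<close>, expressed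
through its quadratic form, so that eigenvectors are never mentioned. It acts entrywise on
functions with values in a Hilbert space \<open>'b\<close>; the type argument exists only because the other
parameters do not determine \<open>'b\<close>. Functions are compared on \<open>T\<close> only.\<close>

locale contracting_matrix =
  fixes T :: "'i set" and q :: "'i \<Rightarrow> 'i \<Rightarrow> real" and \<gamma> :: real
    and vector_type :: "'b::{real_inner, banach} itself"
  assumes finite_T: "finite T"
    and symmetric: "\<And>i j. i \<in> T \<Longrightarrow> j \<in> T \<Longrightarrow> q i j = q j i"
    and psd: "\<And>f::'i \<Rightarrow> 'b. inner_on T f (apply_matrix T q f) \<ge> 0"
    and gap: "\<And>f::'i \<Rightarrow> 'b. inner_on T f (apply_matrix T q f) \<le> (1 - \<gamma>) * inner_on T f f"
    and \<gamma>_pos: "\<gamma> > 0" and \<gamma>_le_1: "\<gamma> \<le> 1"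
begin

abbreviation Q :: "('i \<Rightarrow> 'b) \<Rightarrow> 'i \<Rightarrow> 'b" where "Q \<equiv> apply_matrix T q"

abbreviation ip :: "('i \<Rightarrow> 'b) \<Rightarrow> ('i \<Rightarrow> 'b) \<Rightarrow> real" where "ip \<equiv> inner_on T"

lemma self_adjoint: "ip f (Q g) = ip (Q f) g"
proof -
  have "ip f (Q g) = (\<Sum>i\<in>T. \<Sum>j\<in>T. q i j * (f i \<bullet> g j))"
    by (simp add: inner_on_def apply_matrix_def inner_sum_right)
  also have "\<dots> = (\<Sum>j\<in>T. \<Sum>i\<in>T. q i j * (f i \<bullet> g j))"
    by (rule sum.swap)
  also have "\<dots> = (\<Sum>j\<in>T. \<Sum>i\<in>T. q j i * (f i \<bullet> g j))"
    by (intro sum.cong refl) (simp add: symmetric)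
  also have "\<dots> = ip (Q f) g"
    by (simp add: inner_on_def apply_matrix_def inner_sum_left)
  finally show ?thesis .
qed

text \<open>This is \<open>Q (I - Q) \<ge> 0\<close>. A product of commuting positive operators is positive, but no square
root is needed here: \<open>Q (I - Q) = (I - Q) Q (I - Q) + Q (I - Q) Q\<close>, and both summands are
visibly positive.\<close>

lemma norm_apply_le: "ip (Q f) (Q f) \<le> ip f (Q f)"
proof -
  define h where "h = (\<lambda>i. f i - Q f i)"
  have "0 \<le> ip h (Q h) + (ip (Q f) (Q f) - ip (Q f) (Q (Q f)))"
  proof -
    have "ip (Q f) (Q (Q f)) \<le> (1 - \<gamma>) * ip (Q f) (Q f)" by (rule gap)
    also have "\<dots> \<le> ip (Q f) (Q f)"
      using \<gamma>_pos inner_on_self_nonneg[of T "Q f"] by (simp add: left_diff_distrib)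
    finally show ?thesis using psd[of h] by simp
  qed
  also have "ip h (Q h) = ip f (Q f) - 2 * ip (Q f) (Q f) + ip (Q f) (Q (Q f))"
    using self_adjoint[of f "Q f"]
    by (simp add: h_def apply_matrix_linear inner_on_linear)
  finally show ?thesis by simp
qed

lemma norm_power_apply_le: "ip ((Q ^^ k) f) ((Q ^^ k) f) \<le> (1 - \<gamma>) ^ k * ip f f"
proof (induction k)
  case (Suc k)
  have "ip ((Q ^^ Suc k) f) ((Q ^^ Suc k) f) \<le> (1 - \<gamma>) * ip ((Q ^^ k) f) ((Q ^^ k) f)"
    using norm_apply_le[of "(Q ^^ k) f"] gap[of "(Q ^^ k) f"] by simp
  also have "\<dots> \<le> (1 - \<gamma>) * ((1 - \<gamma>) ^ k * ip f f)"
    using Suc \<gamma>_le_1 by (intro mult_left_mono) auto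
  finally show ?case by simp
qed simp

text \<open>\<open>I - Q\<close> is onto because the Neumann series \<open>\<Sum>k. (Q ^^ k) f\<close> converges at each index: by the
previous bound its terms decay like \<open>(sqrt (1 - \<gamma>)) ^ k\<close>.\<close>

lemma ex_preimage: "\<exists>g. \<forall>i\<in>T. g i - Q g i = f i"
proof -
  define r where "r = sqrt (1 - \<gamma>)"
  have r: "0 \<le> r" "r < 1" using \<gamma>_pos \<gamma>_le_1 by (auto simp: r_def)
  have bound: "norm ((Q ^^ k) f i) \<le> r ^ k * sqrt (ip f f)" if "i \<in> T" for i k
  proof -
    have "(norm ((Q ^^ k) f i))\<^sup>2 \<le> ip ((Q ^^ k) f) ((Q ^^ k) f)"
      unfolding inner_on_self using that finite_T by (intro member_le_sum) auto
    also have "\<dots> \<le> (1 - \<gamma>) ^ k * ip f f" by (rule norm_power_apply_le)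
    finally have "norm ((Q ^^ k) f i) \<le> sqrt ((1 - \<gamma>) ^ k * ip f f)"
      by (rule real_le_rsqrt)
    then show ?thesis by (simp add: r_def real_sqrt_mult real_sqrt_power)
  qed
  have summ: "summable (\<lambda>k. (Q ^^ k) f i)" if "i \<in> T" for i
  proof (rule summable_comparison_test')
    show "summable (\<lambda>k. r ^ k * sqrt (ip f f))"
      using r by (intro summable_mult2 summable_geometric) auto
    show "\<And>k. 0 \<le> k \<Longrightarrow> norm ((Q ^^ k) f i) \<le> r ^ k * sqrt (ip f f)"
      using bound that by blast
  qed
  define g where "g = (\<lambda>i. \<Sum>k. (Q ^^ k) f i)"
  have "g i - Q g i = f i" if "i \<in> T" for i
  proof -
    have "Q g i = (\<Sum>j\<in>T. q i j *\<^sub>R g j)" by (rule apply_matrix_def)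
    also have "\<dots> = (\<Sum>j\<in>T. \<Sum>k. q i j *\<^sub>R (Q ^^ k) f j)"
      by (simp add: g_def suminf_scaleR_right[OF summ])
    also have "\<dots> = (\<Sum>k. \<Sum>j\<in>T. q i j *\<^sub>R (Q ^^ k) f j)"
      by (intro suminf_sum[symmetric] summable_scaleR_right summ)
    also have "\<dots> = (\<Sum>k. (Q ^^ Suc k) f i)" by (simp add: apply_matrix_def)
    also have "\<dots> = g i - f i" unfolding g_def
      using suminf_split_head[OF summ[OF that]] by simp
    finally show ?thesis by simp
  qed
  then show ?thesis by blast
qed

definition laplacian :: "('i \<Rightarrow> 'b) \<Rightarrow> 'i \<Rightarrow> 'b" where
  "laplacian f = (\<lambda>i. f i - Q f i)"

lemma laplacian_linear:
  "laplacian (\<lambda>i. f i + g i) = (\<lambda>i. laplacian f i + laplacian g i)"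
  "laplacian (\<lambda>i. f i - g i) = (\<lambda>i. laplacian f i - laplacian g i)"
  "laplacian (\<lambda>i. c *\<^sub>R f i) = (\<lambda>i. c *\<^sub>R laplacian f i)"
  by (auto simp: laplacian_def apply_matrix_linear algebra_simps)

lemma laplacian_self_adjoint: "ip f (laplacian g) = ip (laplacian f) g"
  by (simp add: laplacian_def inner_on_linear self_adjoint)

lemma laplacian_ge: "\<gamma> * ip f f \<le> ip f (laplacian f)"
  using gap[of f] by (simp add: laplacian_def inner_on_linear algebra_simps)

lemma laplacian_nonneg: "0 \<le> ip f (laplacian f)"
  using laplacian_ge[of f] \<gamma>_pos inner_on_self_nonneg[of T f] by (smt (verit) mult_nonneg_nonneg)

lemma norm_laplacian_le: "ip (laplacian f) (laplacian f) \<le> ip f (laplacian f)"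
  using norm_apply_le[of f] by (simp add: laplacian_def inner_on_linear inner_on_commute[of T "Q f" f])

text \<open>With \<open>L = I - Q\<close>, this is \<open>L\<^sup>2 - \<gamma> L \<ge> 0\<close>, which holds since
\<open>L\<^sup>2 - \<gamma> L = (L - \<gamma>)\<^sup>2 + \<gamma> (L - \<gamma>)\<close>.\<close>

lemma norm_laplacian_ge: "\<gamma> * ip f (laplacian f) \<le> ip (laplacian f) (laplacian f)"
proof -
  have "0 \<le> ip (\<lambda>i. laplacian f i - \<gamma> *\<^sub>R f i) (\<lambda>i. laplacian f i - \<gamma> *\<^sub>R f i) + \<gamma> * (ip f (laplacian f) - \<gamma> * ip f f)"
    using laplacian_ge[of f] \<gamma>_pos by (intro add_nonneg_nonneg inner_on_self_nonneg mult_nonneg_nonneg) auto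
  also have "\<dots> = ip (laplacian f) (laplacian f) - \<gamma> * ip f (laplacian f)"
    by (simp add: inner_on_linear inner_on_commute[of T "laplacian f" f] algebra_simps)
  finally show ?thesis by simp
qed

section \<open>Nesterov acceleration\<close>

text \<open>Write \<open>L\<close> for \<open>laplacian\<close>, that is \<open>I - Q\<close>, and let \<open>y = L g\<close> and \<open>x = L p\<close> be the current
iterates. With \<open>u = (1 + \<eta>) x - \<eta> y\<close> the function below is \<open>|y|\<^sup>2 + \<gamma> \<langle>u, L\<^sup>-\<^sup>1 u\<rangle>\<close>; passing to
the preimages \<open>g\<close> and \<open>p\<close> removes the inverse. On an eigenvector of \<open>L\<close> with eigenvalue \<open>a\<close> it
is Nesterov's potential \<open>a y\<^sup>2 / 2 + \<gamma> u\<^sup>2 / 2\<close> for minimising \<open>a y\<^sup>2 / 2\<close>, rescaled by \<open>2 / a\<close>.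
The rescaling makes it comparable to \<open>|y|\<^sup>2\<close> itself, with a constant independent of \<open>\<gamma>\<close>.\<close>

definition lyapunov :: "real \<Rightarrow> ('i \<Rightarrow> 'b) \<Rightarrow> ('i \<Rightarrow> 'b) \<Rightarrow> real" where
  "lyapunov \<eta> g p = ip (laplacian g) (laplacian g) +
     \<gamma> * ip (\<lambda>i. (1 + \<eta>) *\<^sub>R p i - \<eta> *\<^sub>R g i) (laplacian (\<lambda>i. (1 + \<eta>) *\<^sub>R p i - \<eta> *\<^sub>R g i))"

text \<open>Here \<open>Q p\<close> and \<open>p'\<close> are the preimages of the next iterates. With \<open>L = I - Q\<close>, the decrease
\<open>(1 - 1/\<eta>) lyapunov \<eta> g p - lyapunov \<eta> (Q p) p'\<close> is exactly the sum of the nonnegative terms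
\<^item> \<open>\<langle>x, L (I - L) x\<rangle>\<close>,
\<^item> \<open>(1 - 1/\<eta>) |x - y|\<^sup>2\<close>,
\<^item> \<open>(1 - 1/\<eta>) (1/\<eta>) \<langle>p - g, x - y\<rangle>\<close>,
\<^item> \<open>(1/\<eta>) (|x|\<^sup>2 - \<gamma> \<langle>p, x\<rangle>)\<close>.

The first comes from \<open>L \<le> I\<close>, the third from \<open>L \<ge> 0\<close> and the last from \<open>L \<ge> \<gamma>\<close>.\<close>

lemma lyapunov_step:
  assumes \<eta>: "\<eta> \<ge> 1" and \<gamma>: "\<gamma> = 1 / \<eta>\<^sup>2"
    and p': "\<And>i. p' i = Q p i + ((\<eta> - 1) / (\<eta> + 1)) *\<^sub>R (Q p i - g i)"
  shows "lyapunov \<eta> (Q p) p' \<le> (1 - 1 / \<eta>) * lyapunov \<eta> g p"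
proof -
  define X Y where "X = laplacian p" and "Y = laplacian g"
  define Z where "Z = laplacian X"
  have Qp: "Q p = (\<lambda>i. p i - X i)" by (simp add: X_def laplacian_def)
  have coeff: "(1 + \<eta>) * ((\<eta> - 1) / (\<eta> + 1)) = \<eta> - 1" using \<eta> by (simp add: field_simps)
  have mom: "(\<lambda>i. (1 + \<eta>) *\<^sub>R p' i - \<eta> *\<^sub>R Q p i) = (\<lambda>i. \<eta> *\<^sub>R (p i - X i) - (\<eta> - 1) *\<^sub>R g i)"
  proof
    fix i
    have "(1 + \<eta>) *\<^sub>R p' i = (1 + \<eta>) *\<^sub>R Q p i + (\<eta> - 1) *\<^sub>R (Q p i - g i)"
      unfolding p' scaleR_add_right scaleR_scaleR coeff ..
    then show "(1 + \<eta>) *\<^sub>R p' i - \<eta> *\<^sub>R Q p i = \<eta> *\<^sub>R (p i - X i) - (\<eta> - 1) *\<^sub>R g i"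
      by (simp add: Qp algebra_simps)
  qed
  \<comment> \<open>Self-adjointness expresses every inner product that occurs in the two potentials through
      eight of them, which turns the claim into an identity between polynomials.\<close>
  have pZ: "ip p Z = ip X X" unfolding Z_def X_def by (rule laplacian_self_adjoint)
  have gZ: "ip g Z = ip X Y" unfolding Z_def Y_def
    by (subst laplacian_self_adjoint) (rule inner_on_commute)
  have pY: "ip p Y = ip g X" unfolding Y_def X_def
    by (subst laplacian_self_adjoint) (rule inner_on_commute)
  have comm: "ip Z X = ip X Z" "ip Y X = ip X Y" by (simp_all add: inner_on_commute)
  have L: "lyapunov \<eta> g p = ip Y Y + \<gamma> * ((1 + \<eta>)\<^sup>2 * ip p X - 2 * \<eta> * (1 + \<eta>) * ip g X + \<eta>\<^sup>2 * ip g Y)"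
    unfolding lyapunov_def laplacian_linear X_def[symmetric] Y_def[symmetric] inner_on_linear pY
    by (simp add: power2_eq_square algebra_simps)
  have L': "lyapunov \<eta> (Q p) p' = ip X X - 2 * ip X Z + ip Z Z
      + \<gamma> * (\<eta>\<^sup>2 * (ip p X - 2 * ip X X + ip X Z)
             - 2 * \<eta> * (\<eta> - 1) * (ip g X - ip X Y) + (\<eta> - 1)\<^sup>2 * ip g Y)"
    unfolding lyapunov_def mom
    unfolding Qp laplacian_linear X_def[symmetric] Y_def[symmetric] Z_def[symmetric] inner_on_linear pY pZ gZ comm
    by (simp add: power2_eq_square algebra_simps)
  \<comment> \<open>The four nonnegative terms of the decrease, up to their coefficients.\<close>
  have N1: "0 \<le> ip X Z - ip Z Z" using norm_laplacian_le[of X] by (simp add: Z_def)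
  have N2: "0 \<le> ip X X - 2 * ip X Y + ip Y Y"
    using inner_on_self_nonneg[of T "\<lambda>i. X i - Y i"] by (simp add: inner_on_linear comm)
  have N3: "0 \<le> ip p X - 2 * ip g X + ip g Y"
    using laplacian_nonneg[of "\<lambda>i. p i - g i"]
    by (simp add: laplacian_linear inner_on_linear X_def[symmetric] Y_def[symmetric] pY)
  have N4: "0 \<le> ip X X - \<gamma> * ip p X" using norm_laplacian_ge[of p] by (simp add: X_def)
  have "0 \<le> (ip X Z - ip Z Z) + (1 - 1 / \<eta>) * (ip X X - 2 * ip X Y + ip Y Y)
      + (1 - 1 / \<eta>) * (1 / \<eta>) * (ip p X - 2 * ip g X + ip g Y)
      + (1 / \<eta>) * (ip X X - \<gamma> * ip p X)"
    using \<eta> by (intro add_nonneg_nonneg[OF add_nonneg_nonneg[OF add_nonneg_nonneg]] mult_nonneg_nonneg[OF _ N2]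
        mult_nonneg_nonneg[OF _ N3] mult_nonneg_nonneg[OF _ N4] N1) auto
  also have "\<dots> = (1 - 1 / \<eta>) * lyapunov \<eta> g p - lyapunov \<eta> (Q p) p'"
    unfolding L L' unfolding \<gamma> using \<eta> by (simp add: field_simps power2_eq_square power3_eq_cube)
  finally show ?thesis by simp
qed

text \<open>Nesterov's method with condition number \<open>\<eta>\<^sup>2\<close>, with an error bound on the iterates themselves.
The induction carries preimages of the two iterates under \<open>I - Q\<close>. The potential dominates
\<open>|y|\<^sup>2\<close>; initially \<open>u = x = y\<close>, so its second summand \<open>\<gamma> \<langle>u, (I - Q)\<^sup>-\<^sup>1 u\<rangle>\<close> is at most \<open>|y|\<^sup>2\<close>,
whence the factor 2.\<close>

theorem accelerated_iteration:
  assumes \<eta>: "\<eta> \<ge> 1" and \<gamma>: "\<gamma> = 1 / \<eta>\<^sup>2"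
    and init: "\<And>i. i \<in> T \<Longrightarrow> x 0 i = y 0 i"
    and y_step: "\<And>t i. i \<in> T \<Longrightarrow> y (Suc t) i = Q (x t) i"
    and x_step: "\<And>t i. i \<in> T \<Longrightarrow>
      x (Suc t) i = y (Suc t) i + ((\<eta> - 1) / (\<eta> + 1)) *\<^sub>R (y (Suc t) i - y t i)"
  shows "ip (y t) (y t) \<le> 2 * (1 - 1 / \<eta>) ^ t * ip (y 0) (y 0)"
proof -
  have "\<exists>g p. (\<forall>i\<in>T. laplacian g i = y t i) \<and> (\<forall>i\<in>T. laplacian p i = x t i) \<and>
      lyapunov \<eta> g p \<le> (1 - 1 / \<eta>) ^ t * (2 * ip (y 0) (y 0))"
  proof (induction t)
    case 0
    \<comment> \<open>Both iterates start at the same point, so one preimage serves for both.\<close>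
    obtain g where g: "\<forall>i\<in>T. laplacian g i = y 0 i"
      using ex_preimage[of "y 0"] by (auto simp: laplacian_def)
    have "(\<lambda>i. (1 + \<eta>) *\<^sub>R g i - \<eta> *\<^sub>R g i) = g" by (simp add: algebra_simps)
    then have "lyapunov \<eta> g g = ip (laplacian g) (laplacian g) + \<gamma> * ip g (laplacian g)" by (simp add: lyapunov_def)
    also have "\<dots> \<le> 2 * ip (laplacian g) (laplacian g)" using norm_laplacian_ge[of g] by simp
    also have "ip (laplacian g) (laplacian g) = ip (y 0) (y 0)" using g by (intro inner_on_cong) auto
    finally show ?case using g init by (intro exI[of _ g]) auto
  next
    case (Suc t)
    then obtain g p where g: "\<forall>i\<in>T. laplacian g i = y t i" and p: "\<forall>i\<in>T. laplacian p i = x t i"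
      and L: "lyapunov \<eta> g p \<le> (1 - 1 / \<eta>) ^ t * (2 * ip (y 0) (y 0))" by blast
    define p' where "p' = (\<lambda>i. Q p i + ((\<eta> - 1) / (\<eta> + 1)) *\<^sub>R (Q p i - g i))"
    have laplacian_Q: "laplacian (Q p) i = y (Suc t) i" if "i \<in> T" for i
    proof -
      have "laplacian (Q p) i = Q (laplacian p) i" by (simp add: laplacian_def apply_matrix_linear)
      also have "Q (laplacian p) = Q (x t)" using p by (intro apply_matrix_cong) auto
      finally show ?thesis using y_step that by simp
    qed
    moreover have "laplacian p' i = x (Suc t) i" if "i \<in> T" for i
      unfolding p'_def laplacian_linear using that by (simp add: laplacian_Q g x_step)
    moreover have "lyapunov \<eta> (Q p) p' \<le> (1 - 1 / \<eta>) ^ Suc t * (2 * ip (y 0) (y 0))"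
    proof -
      have "lyapunov \<eta> (Q p) p' \<le> (1 - 1 / \<eta>) * lyapunov \<eta> g p"
        by (rule lyapunov_step[OF \<eta> \<gamma>]) (simp add: p'_def)
      also have "\<dots> \<le> (1 - 1 / \<eta>) * ((1 - 1 / \<eta>) ^ t * (2 * ip (y 0) (y 0)))"
        using L \<eta> by (intro mult_left_mono) auto
      finally show ?thesis by simp
    qed
    ultimately show ?case by blast
  qed
  then obtain g p where g: "\<forall>i\<in>T. laplacian g i = y t i"
    and L: "lyapunov \<eta> g p \<le> (1 - 1 / \<eta>) ^ t * (2 * ip (y 0) (y 0))" by blast
  have "ip (y t) (y t) = ip (laplacian g) (laplacian g)" using g by (intro inner_on_cong) auto
  also have "\<dots> \<le> lyapunov \<eta> g p"
    unfolding lyapunov_def using \<gamma>_pos laplacian_nonneg by simp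
  finally show ?thesis using L by (simp add: mult_ac)
qed

end

section \<open>Lazy random walks with an absorbing set\<close>

text \<open>The identity minus half of the weighted graph Laplacian. For nonnegative weights with row sums
at most 1, this is the transition matrix of a walk that stays put with probability at least 1/2.\<close>

definition lazy_walk :: "'i set \<Rightarrow> ('i \<Rightarrow> 'i \<Rightarrow> real) \<Rightarrow> 'i \<Rightarrow> 'i \<Rightarrow> real" where
  "lazy_walk V w i j = (if i = j then 1 - (\<Sum>k\<in>V. w i k) / 2 else 0) + w i j / 2"

text \<open>Each edge counts twice, once in either direction; hence the coefficient 1/4 in the form below.\<close>

definition dirichlet_energy :: "'i set \<Rightarrow> ('i \<Rightarrow> 'i \<Rightarrow> real) \<Rightarrow> ('i \<Rightarrow> 'b::real_normed_vector) \<Rightarrow> real" where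
  "dirichlet_energy V w f = (\<Sum>i\<in>V. \<Sum>j\<in>V. w i j * (norm (f i - f j))\<^sup>2)"

text \<open>Fixing the value 0 off \<open>T\<close> amounts to replacing the matrix by its principal submatrix on \<open>T\<close>.\<close>

lemma apply_lazy_walk:
  assumes "finite V" "T \<subseteq> V" "\<And>j. j \<in> V - T \<Longrightarrow> f j = 0" "i \<in> T"
  shows "apply_matrix T (lazy_walk V w) f i = f i + (1/2) *\<^sub>R (\<Sum>j\<in>V. w i j *\<^sub>R (f j - f i))"
proof -
  have "apply_matrix T (lazy_walk V w) f i = (\<Sum>j\<in>V. lazy_walk V w i j *\<^sub>R f j)"
    unfolding apply_matrix_def using assms by (intro sum.mono_neutral_left) auto
  also have "\<dots> = (\<Sum>j\<in>V. (if i = j then (1 - (\<Sum>k\<in>V. w i k) / 2) *\<^sub>R f j else 0) + (w i j / 2) *\<^sub>R f j)"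
    by (intro sum.cong refl) (auto simp: lazy_walk_def scaleR_add_left)
  also have "\<dots> = (1 - (\<Sum>k\<in>V. w i k) / 2) *\<^sub>R f i + (\<Sum>j\<in>V. (w i j / 2) *\<^sub>R f j)"
    using assms by (auto simp: sum.distrib)
  also have "\<dots> = f i + (1/2) *\<^sub>R (\<Sum>j\<in>V. w i j *\<^sub>R (f j - f i))"
    by (simp add: scaleR_diff_left scaleR_diff_right sum_subtractf scaleR_sum_right scaleR_sum_left[symmetric] sum_divide_distrib[symmetric])
  finally show ?thesis .
qed

text \<open>Summation by parts: exchanging the roles of \<open>i\<close> and \<open>j\<close> turns \<open>f i \<bullet> (f i - f j)\<close> into half of
the squared difference.\<close>

lemma lazy_walk_form:
  fixes f :: "'i \<Rightarrow> 'b::real_inner"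
  assumes "finite V" "T \<subseteq> V" "\<And>j. j \<in> V - T \<Longrightarrow> f j = 0"
    and sym: "\<And>i j. i \<in> V \<Longrightarrow> j \<in> V \<Longrightarrow> w i j = w j i"
  shows "inner_on T f (apply_matrix T (lazy_walk V w) f) = inner_on V f f - dirichlet_energy V w f / 4"
proof -
  have "inner_on T f (apply_matrix T (lazy_walk V w) f)
      = (\<Sum>i\<in>T. f i \<bullet> (f i + (1/2) *\<^sub>R (\<Sum>j\<in>V. w i j *\<^sub>R (f j - f i))))"
    unfolding inner_on_def
  proof (intro sum.cong refl)
    fix i assume "i \<in> T"
    from apply_lazy_walk[OF assms(1-3) this]
    show "f i \<bullet> apply_matrix T (lazy_walk V w) f i
        = f i \<bullet> (f i + (1/2) *\<^sub>R (\<Sum>j\<in>V. w i j *\<^sub>R (f j - f i)))"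
      by simp
  qed
  also have "\<dots> = (\<Sum>i\<in>V. f i \<bullet> (f i + (1/2) *\<^sub>R (\<Sum>j\<in>V. w i j *\<^sub>R (f j - f i))))"
    using assms by (intro sum.mono_neutral_left) auto
  also have "\<dots> = inner_on V f f - (\<Sum>i\<in>V. \<Sum>j\<in>V. w i j * (f i \<bullet> (f i - f j))) / 2"
    by (simp add: inner_on_def inner_add_right inner_sum_right sum.distrib inner_diff_right
       sum_subtractf right_diff_distrib sum_distrib_left field_simps sum_divide_distrib)
  also have "(\<Sum>i\<in>V. \<Sum>j\<in>V. w i j * (f i \<bullet> (f i - f j))) = dirichlet_energy V w f / 2"
  proof -
    have "(\<Sum>i\<in>V. \<Sum>j\<in>V. w i j * (f i \<bullet> (f i - f j))) = (\<Sum>j\<in>V. \<Sum>i\<in>V. w i j * (f i \<bullet> (f i - f j)))"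
      by (rule sum.swap)
    also have "\<dots> = (\<Sum>j\<in>V. \<Sum>i\<in>V. w j i * (f i \<bullet> (f i - f j)))"
      by (intro sum.cong refl) (simp add: sym)
    finally have "2 * (\<Sum>i\<in>V. \<Sum>j\<in>V. w i j * (f i \<bullet> (f i - f j)))
      = (\<Sum>i\<in>V. \<Sum>j\<in>V. w i j * (f i \<bullet> (f i - f j))) + (\<Sum>i\<in>V. \<Sum>j\<in>V. w i j * (f j \<bullet> (f j - f i)))"
      by simp
    also have "\<dots> = dirichlet_energy V w f"
      unfolding dirichlet_energy_def sum.distrib[symmetric]
      by (intro sum.cong refl) (simp add: power2_norm_eq_inner inner_diff_left inner_diff_right inner_commute algebra_simps)
    finally show ?thesis by simp
  qed
  finally show ?thesis by simp
qed

text \<open>Follows from \<open>|a - b|\<^sup>2 \<le> 2 |a|\<^sup>2 + 2 |b|\<^sup>2\<close>. The energy enters the form of the lazy walk with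
coefficient 1/4, so that form is nonnegative.\<close>

lemma dirichlet_energy_le:
  fixes f :: "'i \<Rightarrow> 'b::real_inner"
  assumes sym: "\<And>i j. i \<in> V \<Longrightarrow> j \<in> V \<Longrightarrow> w i j = w j i"
    and nonneg: "\<And>i j. w i j \<ge> 0"
    and row: "\<And>i. i \<in> V \<Longrightarrow> (\<Sum>j\<in>V. w i j) \<le> 1"
  shows "dirichlet_energy V w f \<le> 4 * inner_on V f f"
proof -
  have "dirichlet_energy V w f \<le> (\<Sum>i\<in>V. \<Sum>j\<in>V. w i j * (2 * (norm (f i))\<^sup>2 + 2 * (norm (f j))\<^sup>2))"
    unfolding dirichlet_energy_def
  proof (intro sum_mono mult_left_mono nonneg)
    fix i j
    have "(norm (f i - f j))\<^sup>2 + (norm (f i + f j))\<^sup>2 = 2 * (norm (f i))\<^sup>2 + 2 * (norm (f j))\<^sup>2"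
      by (simp add: power2_norm_eq_inner inner_add_left inner_add_right inner_diff_left inner_diff_right inner_commute)
    then show "(norm (f i - f j))\<^sup>2 \<le> 2 * (norm (f i))\<^sup>2 + 2 * (norm (f j))\<^sup>2"
      by (smt (verit) zero_le_power2)
  qed
  also have "\<dots> = 2 * (\<Sum>i\<in>V. \<Sum>j\<in>V. w i j * (norm (f i))\<^sup>2) + 2 * (\<Sum>i\<in>V. \<Sum>j\<in>V. w i j * (norm (f j))\<^sup>2)"
    by (simp add: distrib_left sum.distrib sum_distrib_left mult_ac)
  also have "(\<Sum>i\<in>V. \<Sum>j\<in>V. w i j * (norm (f j))\<^sup>2) = (\<Sum>j\<in>V. \<Sum>i\<in>V. w i j * (norm (f j))\<^sup>2)"
    by (rule sum.swap)
  also have "\<dots> = (\<Sum>j\<in>V. \<Sum>i\<in>V. w j i * (norm (f j))\<^sup>2)"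
    by (intro sum.cong refl) (simp add: sym)
  also have "(\<Sum>i\<in>V. \<Sum>j\<in>V. w i j * (norm (f i))\<^sup>2) = (\<Sum>i\<in>V. (\<Sum>j\<in>V. w i j) * (norm (f i))\<^sup>2)"
    by (simp add: sum_distrib_right)
  also have "2 * \<dots> + 2 * \<dots> \<le> 2 * (\<Sum>i\<in>V. 1 * (norm (f i))\<^sup>2) + 2 * (\<Sum>i\<in>V. 1 * (norm (f i))\<^sup>2)"
    by (intro add_mono mult_left_mono sum_mono mult_right_mono row) auto
  finally show ?thesis by (simp add: inner_on_self)
qed

section \<open>Metropolis weights on a graph\<close>

definition metropolis :: "'a pair_pre_digraph \<Rightarrow> 'a \<Rightarrow> 'a \<Rightarrow> real" where
  "metropolis G i j = (if (i, j) \<in> parcs G then 1 / real (max (deg G i) (deg G j)) else 0)"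

context pair_graph
begin

lemma arc_sym: "(i, j) \<in> parcs G \<longleftrightarrow> (j, i) \<in> parcs G"
  using arcs_symmetric pair_sym_arcs unfolding symmetric_def sym_def by auto

lemma deg_eq_card: "deg G i = card (nbrs G i)"
proof -
  have "out_arcs G i = Pair i ` nbrs G i" by (auto simp: out_arcs_def)
  then show ?thesis by (simp add: out_degree_def card_image inj_on_def)
qed

lemma finite_nbrs: "finite (nbrs G i)"
  by (rule finite_subset[of _ "pverts G"]) (auto simp: in_arcsD2)

lemma deg_pos: "(i, j) \<in> parcs G \<Longrightarrow> deg G i > 0"
  using finite_nbrs[of i] by (auto simp: deg_eq_card card_gt_0_iff)

lemma metropolis_sym: "metropolis G i j = metropolis G j i"
  by (simp add: metropolis_def arc_sym[of i j] max.commute)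

lemma metropolis_nonneg: "metropolis G i j \<ge> 0"
  by (simp add: metropolis_def)

lemma sum_metropolis:
  "(\<Sum>j\<in>pverts G. metropolis G i j *\<^sub>R f j) = (\<Sum>j\<in>nbrs G i. (f j :: 'b::real_vector) /\<^sub>R real (max (deg G i) (deg G j)))"
proof -
  have "(\<Sum>j\<in>pverts G. metropolis G i j *\<^sub>R f j) = (\<Sum>j\<in>nbrs G i. metropolis G i j *\<^sub>R f j)"
    by (intro sum.mono_neutral_right) (auto simp: metropolis_def in_arcsD2)
  then show ?thesis by (auto simp: metropolis_def divide_inverse)
qed

lemma metropolis_row: "(\<Sum>j\<in>pverts G. metropolis G i j) \<le> 1"
proof -
  have "(\<Sum>j\<in>pverts G. metropolis G i j) = (\<Sum>j\<in>nbrs G i. 1 / real (max (deg G i) (deg G j)))"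
    using sum_metropolis[of i "\<lambda>_. 1::real"] by (simp add: divide_inverse)
  also have "\<dots> \<le> (\<Sum>j\<in>nbrs G i. 1 / real (deg G i))"
    by (intro sum_mono frac_le) (auto dest: deg_pos)
  also have "\<dots> \<le> 1" by (simp add: deg_eq_card)
  finally show ?thesis .
qed

section \<open>A Poincare inequality for Metropolis weights\<close>

text \<open>The graph distance to \<open>S\<close> is such a function. The three properties listed are all that the
estimate along shortest paths uses.\<close>

lemma ex_level_function:
  assumes conn: "Digraph_Component.connected G" and S: "S \<noteq> {}" "S \<subseteq> pverts G"
  shows "\<exists>h :: 'a \<Rightarrow> nat. (\<forall>i\<in>pverts G. h i = 0 \<longrightarrow> i \<in> S) \<and>
    (\<forall>i\<in>pverts G. h i > 0 \<longrightarrow> (\<exists>j. (i, j) \<in> parcs G \<and> h i = Suc (h j))) \<and>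
    (\<forall>i j. (i, j) \<in> parcs G \<longrightarrow> h i \<le> Suc (h j))"
proof -
  define reach where "reach k i \<longleftrightarrow> (\<exists>s\<in>S. (i, s) \<in> parcs G ^^ k)" for k i
  define h where "h i = (LEAST k. reach k i)" for i
  have ex: "\<exists>k. reach k i" if "i \<in> pverts G" for i
  proof -
    obtain s where s: "s \<in> S" using S by auto
    have "strongly_connected G" using conn pair_sym_arcs
      by (metis connected_def Digraph_Component.connected_def symmetric_connected_imp_strongly_connected)
    then have "i \<rightarrow>\<^sup>*\<^bsub>with_proj G\<^esub> s" using that s S by (auto simp: strongly_connected_def)
    then have "(i, s) \<in> (parcs G)\<^sup>*" by (auto simp: reachable_def intro: rtrancl_on_rtranclI)
    then show ?thesis using s unfolding reach_def by (meson rtrancl_imp_relpow)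
  qed
  have h: "reach (h i) i" if "i \<in> pverts G" for i
    unfolding h_def using ex[OF that] by (rule LeastI_ex)
  have h_le: "h i \<le> k" if "reach k i" for i k
    unfolding h_def using that by (rule Least_le)
  have lip: "h i \<le> Suc (h j)" if "(i, j) \<in> parcs G" for i j
  proof (rule h_le)
    show "reach (Suc (h j)) i"
      using h[OF in_arcsD2[OF that]] that unfolding reach_def by (metis relpow_Suc_I2)
  qed
  have "\<exists>j. (i, j) \<in> parcs G \<and> h i = Suc (h j)" if i: "i \<in> pverts G" and pos: "h i > 0" for i
  proof -
    obtain k where k: "h i = Suc k" using pos gr0_conv_Suc by auto
    then obtain s j where "s \<in> S" "(i, j) \<in> parcs G" "(j, s) \<in> parcs G ^^ k"
      using h[OF i] unfolding reach_def by (metis relpow_Suc_D2)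
    then show ?thesis using lip[of i j] h_le[of k j] k unfolding reach_def
      by (metis Suc_le_mono le_antisym)
  qed
  then show ?thesis using lip h by (intro exI[of _ h]) (fastforce simp: reach_def)
qed

text \<open>Descend from a vertex \<open>i\<close> to \<open>S\<close>, one level of the distance to \<open>S\<close> at a time. An arc from level
\<open>l\<close> to level \<open>l - 1\<close> has resistance \<open>max (deg i) (deg j)\<close>. All neighbours of its ends lie in the
four levels \<open>l - 2, ..., l + 1\<close>, so the resistance is at most the number \<open>m l\<close> of vertices
there. Each vertex belongs to at most four of these windows, so the resistances along the
descent add up to at most \<open>4 n\<close>, where \<open>n\<close> is the number of vertices: this is why the bound is
quadratic in \<open>n\<close> rather than cubic. The arcs leaving different levels are distinct, so their
energies \<open>E l\<close> add up to at most the total energy. By the Cauchy-Schwarz inequality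
\<open>|f i|\<^sup>2 \<le> 4 n\<close> times the energy, and it remains to sum over the \<open>n\<close> vertices.\<close>

lemma poincare:
  fixes f :: "'a \<Rightarrow> 'b::real_inner"
  assumes conn: "Digraph_Component.connected G" and S: "S \<noteq> {}" "S \<subseteq> pverts G"
    and zero: "\<And>i. i \<in> S \<Longrightarrow> f i = 0"
  shows "inner_on (pverts G) f f
    \<le> 4 * (real (card (pverts G)))\<^sup>2 * dirichlet_energy (pverts G) (metropolis G) f"
proof -
  let ?V = "pverts G"
  obtain h :: "'a \<Rightarrow> nat" where h0: "\<And>i. i \<in> ?V \<Longrightarrow> h i = 0 \<Longrightarrow> i \<in> S"
    and down: "\<And>i. i \<in> ?V \<Longrightarrow> h i > 0 \<Longrightarrow> \<exists>j. (i, j) \<in> parcs G \<and> h i = Suc (h j)"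
    and lip: "\<And>i j. (i, j) \<in> parcs G \<Longrightarrow> h i \<le> Suc (h j)"
    using ex_level_function[OF conn S] by blast
  define e where "e i = (\<Sum>j\<in>?V. metropolis G i j * (norm (f i - f j))\<^sup>2)" for i
  define E where "E l = (\<Sum>i\<in>?V. if h i = l then e i else 0)" for l
  define m where "m l = card {u \<in> ?V. h u \<le> l + 1 \<and> l \<le> h u + 2}" for l
  have e_nonneg: "e i \<ge> 0" for i
    unfolding e_def by (intro sum_nonneg mult_nonneg_nonneg metropolis_nonneg) auto
  have E_nonneg: "E l \<ge> 0" for l
    unfolding E_def by (intro sum_nonneg) (auto simp: e_nonneg)
  have drop: "norm (f i - f j) \<le> sqrt (m (h i)) * sqrt (E (h i))"
    if arc: "(i, j) \<in> parcs G" and hi: "h i = Suc (h j)" for i j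
  proof -
    have "nbrs G i \<subseteq> {u \<in> ?V. h u \<le> h i + 1 \<and> h i \<le> h u + 2}"
      using lip arc_sym by (fastforce simp: in_arcsD2)
    moreover have "nbrs G j \<subseteq> {u \<in> ?V. h u \<le> h i + 1 \<and> h i \<le> h u + 2}"
      using lip arc_sym hi by (fastforce simp: in_arcsD2)
    ultimately have "max (deg G i) (deg G j) \<le> m (h i)"
      by (simp add: deg_eq_card m_def card_mono)
    then have max_le: "real (max (deg G i) (deg G j)) \<le> real (m (h i))" by (rule of_nat_mono)
    have i: "i \<in> ?V" and j: "j \<in> ?V" using arc by (auto dest: in_arcsD1 in_arcsD2)
    have "metropolis G i j * (norm (f i - f j))\<^sup>2 \<le> e i"
      unfolding e_def using j by (intro member_le_sum) (auto simp: metropolis_nonneg)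
    also have "e i \<le> E (h i)"
      unfolding E_def using member_le_sum[of i ?V "\<lambda>i'. if h i' = h i then e i' else 0"] i
      by (auto simp: e_nonneg)
    finally have le: "metropolis G i j * (norm (f i - f j))\<^sup>2 \<le> E (h i)" .
    have "(norm (f i - f j))\<^sup>2
        = real (max (deg G i) (deg G j)) * (metropolis G i j * (norm (f i - f j))\<^sup>2)"
      using arc deg_pos[OF arc] by (simp add: metropolis_def)
    also have "\<dots> \<le> m (h i) * E (h i)"
      using le max_le metropolis_nonneg by (intro mult_mono) auto
    finally show ?thesis by (simp add: real_le_rsqrt flip: real_sqrt_mult)
  qed
  have path: "norm (f i) \<le> (\<Sum>l\<in>{1..h i}. sqrt (m l) * sqrt (E l))" if "i \<in> ?V" for i
    using that
  proof (induction "h i" arbitrary: i)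
    case 0
    then show ?case using h0 zero by simp
  next
    case (Suc k)
    then obtain j where j: "(i, j) \<in> parcs G" "h i = Suc (h j)" using down[of i] by auto
    have "norm (f i) \<le> norm (f j) + norm (f i - f j)"
      using norm_triangle_ineq[of "f j" "f i - f j"] by simp
    also have "\<dots> \<le> (\<Sum>l\<in>{1..h j}. sqrt (m l) * sqrt (E l)) + sqrt (m (h i)) * sqrt (E (h i))"
      using Suc j in_arcsD2[OF j(1)] by (intro add_mono drop) auto
    finally show ?case using j(2) by simp
  qed
  have sum_m: "(\<Sum>l\<in>{1..k}. real (m l)) \<le> 4 * real (card ?V)" for k
  proof -
    have "(\<Sum>l\<in>{1..k}. m l) = (\<Sum>l\<in>{1..k}. \<Sum>u\<in>?V. if h u \<le> l + 1 \<and> l \<le> h u + 2 then 1 else 0)"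
      unfolding m_def card_eq_sum by (intro sum.cong refl sum.inter_filter) simp
    also have "\<dots> = (\<Sum>u\<in>?V. \<Sum>l\<in>{1..k}. if h u \<le> l + 1 \<and> l \<le> h u + 2 then 1 else 0)"
      by (rule sum.swap)
    also have "\<dots> = (\<Sum>u\<in>?V. card {l \<in> {1..k}. h u \<le> l + 1 \<and> l \<le> h u + 2})"
      unfolding card_eq_sum by (intro sum.cong refl sum.inter_filter[symmetric]) simp
    also have "\<dots> \<le> (\<Sum>u\<in>?V. 4)"
    proof (rule sum_mono)
      fix u
      \<comment> \<open>For \<open>h u = 0\<close> the truncated subtraction makes the interval shorter.\<close>
      have "card {l \<in> {1..k}. h u \<le> l + 1 \<and> l \<le> h u + 2} \<le> card {h u - 1..h u + 2}"
        by (rule card_mono) auto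
      then show "card {l \<in> {1..k}. h u \<le> l + 1 \<and> l \<le> h u + 2} \<le> 4" by simp
    qed
    finally have "(\<Sum>l\<in>{1..k}. m l) \<le> 4 * card ?V" by simp
    then show ?thesis by (simp flip: of_nat_sum)
  qed
  have sum_E: "(\<Sum>l\<in>{1..k}. E l) \<le> dirichlet_energy ?V (metropolis G) f" for k
  proof -
    have "(\<Sum>l\<in>{1..k}. E l) = (\<Sum>i\<in>?V. \<Sum>l\<in>{1..k}. if h i = l then e i else 0)"
      unfolding E_def by (rule sum.swap)
    also have "\<dots> \<le> (\<Sum>i\<in>?V. e i)"
      by (intro sum_mono) (simp add: e_nonneg)
    finally show ?thesis by (simp add: dirichlet_energy_def e_def)
  qed
  have "inner_on ?V f f \<le> (\<Sum>i\<in>?V. 4 * real (card ?V) * dirichlet_energy ?V (metropolis G) f)"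
    unfolding inner_on_self
  proof (rule sum_mono)
    fix i assume i: "i \<in> ?V"
    have "(norm (f i))\<^sup>2 \<le> (\<Sum>l\<in>{1..h i}. sqrt (m l) * sqrt (E l))\<^sup>2"
      using path[OF i] by (intro power_mono) auto
    also have "\<dots> \<le> (\<Sum>l\<in>{1..h i}. (sqrt (m l))\<^sup>2) * (\<Sum>l\<in>{1..h i}. (sqrt (E l))\<^sup>2)"
      by (rule Cauchy_Schwarz_ineq_sum)
    also have "\<dots> = (\<Sum>l\<in>{1..h i}. real (m l)) * (\<Sum>l\<in>{1..h i}. E l)"
      by (simp add: E_nonneg)
    also have "\<dots> \<le> 4 * real (card ?V) * dirichlet_energy ?V (metropolis G) f"
      by (intro mult_mono sum_m sum_E sum_nonneg) (auto simp: E_nonneg)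
    finally show "(norm (f i))\<^sup>2 \<le> 4 * real (card ?V) * dirichlet_energy ?V (metropolis G) f" .
  qed
  then show ?thesis by (simp add: power2_eq_square mult_ac)
qed

text \<open>The spectral gap of the walk killed on \<open>S\<close>. In \<open>16 n\<^sup>2\<close>, a factor 4 is the one of the Poincare
inequality and the other is the one by which the form of \<open>I - Q\<close> differs from the energy.\<close>

lemma contracting_matrix_lazy_metropolis:
  assumes conn: "Digraph_Component.connected G" and S: "S \<noteq> {}" "S \<subseteq> pverts G"
    and \<gamma>: "0 < \<gamma>" "16 * (real (card (pverts G)))\<^sup>2 * \<gamma> \<le> 1"
  shows "contracting_matrix TYPE('b::{real_inner, banach}) (pverts G - S) (lazy_walk (pverts G) (metropolis G)) \<gamma>"
proof
  let ?V = "pverts G" and ?T = "pverts G - S"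
  let ?q = "lazy_walk ?V (metropolis G)"
  show "finite ?T" by simp
  show "?q i j = ?q j i" for i j
    by (auto simp: lazy_walk_def metropolis_sym[of i j])
  have "card ?V > 0" using S by (auto simp: card_gt_0_iff)
  then have "1 \<le> (real (card ?V))\<^sup>2" by (simp add: one_le_power)
  then have "\<gamma> * 1 \<le> \<gamma> * (real (card ?V))\<^sup>2" using \<gamma> by (intro mult_left_mono) auto
  moreover have "16 * (\<gamma> * (real (card ?V))\<^sup>2) \<le> 1" using \<gamma>(2) by (simp add: mult_ac)
  ultimately show "\<gamma> \<le> 1" using \<gamma>(1) by linarith
  show "0 < \<gamma>" by fact
  fix f :: "'a \<Rightarrow> 'b"
  \<comment> \<open>Only the values off \<open>S\<close> enter the form, so a function may be extended to \<open>S\<close> by 0.\<close>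
  define f0 where "f0 i = (if i \<in> S then 0 else f i)" for i
  have form: "inner_on ?T f (apply_matrix ?T ?q f) = inner_on ?V f0 f0 - dirichlet_energy ?V (metropolis G) f0 / 4"
  proof -
    have "apply_matrix ?T ?q f = apply_matrix ?T ?q f0"
      by (intro apply_matrix_cong) (simp add: f0_def)
    then have "inner_on ?T f (apply_matrix ?T ?q f) = inner_on ?T f0 (apply_matrix ?T ?q f0)"
      by (intro inner_on_cong) (auto simp: f0_def)
    also have "\<dots> = inner_on ?V f0 f0 - dirichlet_energy ?V (metropolis G) f0 / 4"
      by (intro lazy_walk_form) (auto simp: f0_def metropolis_sym)
    finally show ?thesis .
  qed
  have ip: "inner_on ?T f f = inner_on ?V f0 f0"
  proof -
    have "inner_on ?T f f = inner_on ?T f0 f0" by (intro inner_on_cong) (auto simp: f0_def)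
    also have "\<dots> = inner_on ?V f0 f0"
      unfolding inner_on_def by (intro sum.mono_neutral_left) (auto simp: f0_def)
    finally show ?thesis .
  qed
  show "0 \<le> inner_on ?T f (apply_matrix ?T ?q f)"
    unfolding form using dirichlet_energy_le[of ?V "metropolis G" f0]
    by (simp add: metropolis_sym metropolis_nonneg metropolis_row)
  have "\<gamma> * inner_on ?V f0 f0 \<le> \<gamma> * (4 * (real (card ?V))\<^sup>2 * dirichlet_energy ?V (metropolis G) f0)"
    using \<gamma> by (intro mult_left_mono poincare[OF conn S]) (auto simp: f0_def)
  also have "\<dots> = (16 * (real (card ?V))\<^sup>2 * \<gamma>) * (dirichlet_energy ?V (metropolis G) f0 / 4)" by simp
  also have "\<dots> \<le> 1 * (dirichlet_energy ?V (metropolis G) f0 / 4)"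
    using \<gamma> by (intro mult_right_mono)
      (auto simp: dirichlet_energy_def intro!: sum_nonneg mult_nonneg_nonneg metropolis_nonneg)
  finally show "inner_on ?T f (apply_matrix ?T ?q f) \<le> (1 - \<gamma>) * inner_on ?T f f"
    unfolding form ip by (simp add: left_diff_distrib)
qed

end

section \<open>Accelerated consensus with stubborn nodes\<close>

theorem corollary4p3:
  fixes G :: "nat pair_pre_digraph"
    and n :: nat
    and S :: "nat set"
    and v :: "real ^ 'd"
    and x y :: "nat \<Rightarrow> nat \<Rightarrow> real ^ 'd"
    and U :: real
  assumes graph: "connected_graph G" "pverts G = {1..n}"
    and S: "S \<noteq> {}" "S \<subseteq> {1..n}"
    and fixed: "\<And>i t. i \<in> S \<Longrightarrow> t \<ge> 1 \<Longrightarrow> x i t = v \<and> y i t = v"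
    and init: "\<And>i. i \<in> {1..n} - S \<Longrightarrow> y i 1 = x i 1"
    and y_step: "\<And>i t. i \<in> {1..n} - S \<Longrightarrow> t \<ge> 1 \<Longrightarrow>
      y i (t + 1) = x i t
        + (1 / 2) *\<^sub>R (\<Sum>j\<in>nbrs G i. (x j t - x i t) /\<^sub>R real (max (deg G i) (deg G j)))"
    and x_step: "\<And>i t. i \<in> {1..n} - S \<Longrightarrow> t \<ge> 1 \<Longrightarrow>
      x i (t + 1) = y i (t + 1) + (1 - 2 / (18 * U + 1)) *\<^sub>R (y i (t + 1) - y i t)"
    and U: "U \<ge> real n"
  shows "\<forall>t\<ge>1. (\<Sum>i=1..n. (norm (y i t - v))\<^sup>2)
    \<le> 2 * (1 - 1 / (18 * U)) ^ (t - 1) * (\<Sum>i=1..n. (norm (y i 1 - v))\<^sup>2)"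
proof (intro allI impI)
  fix t :: nat assume "t \<ge> 1"
  then obtain k where t: "t = Suc k" by (cases t) auto
  interpret pair_graph G using graph by simp
  define T where "T = {1..n} - S"
  define \<eta> where "\<eta> = 18 * U"
  have "n \<ge> 1" using S by auto
  then have U1: "U \<ge> 1" using U by simp
  then have \<eta>: "\<eta> \<ge> 1" by (simp add: \<eta>_def)
  \<comment> \<open>The gap needed is \<open>1 / (18 U)\<^sup>2\<close>; the available one, \<open>1 / (4 n)\<^sup>2\<close>, is larger.\<close>
  have "16 * (real (card (pverts G)))\<^sup>2 * (1 / \<eta>\<^sup>2) \<le> 1"
  proof -
    have "16 * (real (card (pverts G)))\<^sup>2 = (4 * real n)\<^sup>2"
      using graph by (simp add: power_mult_distrib)
    also have "\<dots> \<le> \<eta>\<^sup>2" using U U1 by (intro power_mono) (auto simp: \<eta>_def)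
    finally show ?thesis using \<eta> by (simp add: field_simps)
  qed
  then interpret contracting_matrix T "lazy_walk {1..n} (metropolis G)" "1 / \<eta>\<^sup>2" "TYPE(real ^ 'd)"
    using contracting_matrix_lazy_metropolis[of S "1 / \<eta>\<^sup>2", where 'b = "real ^ 'd"] graph S \<eta>
    by (simp add: T_def)
  \<comment> \<open>Deviations from the fixed value, with time shifted to start at 0.\<close>
  define \<xi> z where "\<xi> k i = x i (Suc k) - v" and "z k i = y i (Suc k) - v" for k i
  have \<xi>_S: "\<xi> k i = 0" and z_S: "z k i = 0" if "i \<in> S" for k i
    using fixed[OF that, of "Suc k"] by (simp_all add: \<xi>_def z_def)
  have main: "ip (z k) (z k) \<le> 2 * (1 - 1 / \<eta>) ^ k * ip (z 0) (z 0)"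
  proof (rule accelerated_iteration[of _ \<xi>])
    fix i k assume i: "i \<in> T"
    show "\<xi> 0 i = z 0 i" using init[of i] i by (simp add: T_def \<xi>_def z_def)
    show "z (Suc k) i = Q (\<xi> k) i"
    proof -
      have "Q (\<xi> k) i = \<xi> k i + (1/2) *\<^sub>R (\<Sum>j\<in>pverts G. metropolis G i j *\<^sub>R (\<xi> k j - \<xi> k i))"
        using i unfolding graph(2) by (intro apply_lazy_walk) (auto simp: T_def \<xi>_S)
      then show ?thesis using y_step[of i "Suc k"] i
        unfolding sum_metropolis by (simp add: T_def \<xi>_def z_def)
    qed
    have "1 - 2 / (18 * U + 1) = (\<eta> - 1) / (\<eta> + 1)"
      using \<eta> by (simp add: \<eta>_def field_simps)
    then show "\<xi> (Suc k) i = z (Suc k) i + ((\<eta> - 1) / (\<eta> + 1)) *\<^sub>R (z (Suc k) i - z k i)"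
      using x_step[of i "Suc k"] i by (simp add: T_def \<xi>_def z_def)
  qed (use \<eta> in auto)
  have ip: "ip (z k) (z k) = (\<Sum>i=1..n. (norm (y i (Suc k) - v))\<^sup>2)" for k
  proof -
    have "ip (z k) (z k) = (\<Sum>i=1..n. (norm (z k i))\<^sup>2)"
      unfolding inner_on_self by (intro sum.mono_neutral_left) (auto simp: T_def z_S)
    then show ?thesis by (simp add: z_def)
  qed
  show "(\<Sum>i=1..n. (norm (y i t - v))\<^sup>2)
      \<le> 2 * (1 - 1 / (18 * U)) ^ (t - 1) * (\<Sum>i=1..n. (norm (y i 1 - v))\<^sup>2)"
    using main unfolding ip by (simp add: t \<eta>_def)
qed

end
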